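(* For any admissible pair $\mathbf{w},\mathbf{u}\in\mathcal{T}\setminus\{\emptyset\}$, there exist linear isomorphisms $\Phi_{\mathbf{w}}^{\mathbf{u}},\Psi_{\mathbf{w}}^{\mathbf{u}}\in\mathrm{GL}(\mathbb{R}^3)$ such that, for every $M\in\{K,S,T\}$ and every $X\in\mathcal{M}$, $$\Phi_{\mathbf{w}}^{\mathbf{u}}(\tilde{\mathbf{c}}_{M}^{\mathbf{w}X})=\tilde{\mathbf{c}}_{M}^{\mathbf{u}X},\qquad \Psi_{\mathbf{w}}^{\mathbf{u}}(\tilde{\mathbf{g}}_{M}^{\mathbf{w}X})=\tilde{\mathbf{g}}_{M}^{\mathbf{u}X}.$$
   Context: Fix $p,p',q,q',r,r'\in\mathbb{R}_{>0}$ with $pp'=qq'=rr'=4$ and $pqr=p'q'r'$, a global sign, and $B=\pm\begin{pmatrix}0&-p'&r\\ p&0&-q'\\ -r'&q&0\end{pmatrix}$ ($B$-invariant type). Fix $D=\mathrm{diag}(d_1,d_2,d_3)$ with $d_i>0$ and $DB$ skew-symmetric. A sequence $\mathbf{w}=[k_1,\dots,k_n]$ of elements of $\{1,2,3\}$ is reduced if $k_j\neq k_{j+1}$ for all $j$; $|\mathbf w|=n$; $\mathcal{T}$ is the set of all reduced sequences, including the empty one $\emptyset$; for $k\ne k_n$, $\mathbf{w}[k]=[k_1,\dots,k_n,k]$. Put $B^{\mathbf{w}}=(b_{ij}^{\mathbf{w}})=(-1)^{|\mathbf{w}|}B$. The $c$-vectors $\mathbf{c}_j^{\mathbf{w}}=(c_{ij}^{\mathbf{w}})_{i=1}^3$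 and $g$-vectors $\mathbf{g}_j^{\mathbf{w}}=(g_{ij}^{\mathbf{w}})_{i=1}^3$ in $\mathbb{R}^3$ are defined by $\mathbf{c}_j^{\emptyset}=\mathbf{g}_j^{\emptyset}=\mathbf{e}_j$ and: $c_{ik}^{\mathbf{w}[k]}=-c_{ik}^{\mathbf{w}}$; $c_{ij}^{\mathbf{w}[k]}=c_{ij}^{\mathbf{w}}+c_{ik}^{\mathbf{w}}\max(b_{kj}^{\mathbf{w}},0)+\max(-c_{ik}^{\mathbf{w}},0)b_{kj}^{\mathbf{w}}$ for $j\ne k$; $g_{ij}^{\mathbf{w}[k]}=g_{ij}^{\mathbf{w}}$ for $j\neq k$; $g_{ik}^{\mathbf{w}[k]}=-g_{ik}^{\mathbf{w}}+\sum_{l}g_{il}^{\mathbf{w}}\max(-b_{lk}^{\mathbf{w}},0)-\sum_l b_{il}^{\emptyset}\max(-c_{lk}^{\mathbf{w}},0)$. The modified vectors are $\tilde{\mathbf{c}}_j^{\mathbf{w}}=d_j^{-1/2}\mathbf{c}_j^{\mathbf{w}}$, $\tilde{\mathbf{g}}_j^{\mathbf{w}}=d_j^{-1/2}\mathbf{g}_j^{\mathbf{w}}$. It is known that each $\mathbf{c}_j^{\mathbf{w}}$ is nonzero with all entries $\ge0$ or all entries $\le0$; let $\varepsilon_j^{\mathbf{w}}\in\{\pm1\}$ be its sign. For $\mathbf{w}\neq\emptyset$ define $K(\mathbf{w}),S(\mathbf{w}),T(\mathbf{w})$ with $\{K(\mathbf w),S(\mathbf w),T(\mathbf w)\}=\{1,2,3\}$: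 $k=K(\mathbf{w})$ is the last index of $\mathbf{w}$; $s=S(\mathbf{w})$ is the (known to be unique) index $s\ne k$ with $\varepsilon_s^{\mathbf{w}}\neq\varepsilon_k^{\mathbf{w}}$ and $\varepsilon_s^{\mathbf{w}}b_{ks}^{\mathbf{w}}<0$; $T(\mathbf{w})$ is the remaining index. For $M\in\{K,S,T\}$ write $\tilde{\mathbf{c}}_M^{\mathbf{w}}=\tilde{\mathbf{c}}_{M(\mathbf{w})}^{\mathbf{w}}$, $\tilde{\mathbf{g}}_M^{\mathbf{w}}=\tilde{\mathbf{g}}_{M(\mathbf{w})}^{\mathbf{w}}$. $\mathcal{M}$ is the free monoid on two letters $S,T$, acting on the right on $\mathcal{T}\setminus\{\emptyset\}$ by $\mathbf{w}S=\mathbf{w}[S(\mathbf{w})]$, $\mathbf{w}T=\mathbf{w}[T(\mathbf{w})]$. Every $\mathbf{w}\ne\emptyset$ is uniquely $[i]X$ with $i\in\{1,2,3\}$, $X\in\mathcal{M}$. We say $\mathbf{w}=[i]X$ is in a trunk if $X=S^n$ for some $n\ge 0$, and in a branch if $X$ contains at least one letter $T$. A pair $\mathbf{w},\mathbf{u}\in\mathcal{T}\setminus\{\emptyset\}$ is admissible if both are in trunks (not necessarily with the same initial index) or both are in branches. *)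

theory Defs
  imports "HOL-Analysis.Analysis"
begin

text \<open>
  The index set {1,2,3} is the type \<open>3\<close> (where \<open>3 = 0\<close>), so that
  vectors are of type \<open>real^3\<close> and matrices of type \<open>real^3^3\<close>.
\<close>

definition diag_mat :: "real^3 \<Rightarrow> real^3^3" where
  "diag_mat d = (\<chi> i j. if i = j then d $ i else 0)"

definition skew_symmetric :: "real^3^3 \<Rightarrow> bool" where
  "skew_symmetric A \<longleftrightarrow> transpose A = - A"

definition reduced_seqs :: "3 list set" where
  "reduced_seqs = {w. \<forall>j. Suc j < length w \<longrightarrow> w ! j \<noteq> w ! Suc j}"

definition bmat :: "real^3^3 \<Rightarrow> 3 list \<Rightarrow> real^3^3" where
  "bmat B w = (- 1) ^ length w *\<^sub>R B"

text \<open>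
  The mutation rules below are stated for all lists, reduced or not; only the values at
  reduced sequences matter.
\<close>

function cmat :: "real^3^3 \<Rightarrow> 3 list \<Rightarrow> real^3^3" where
  "cmat B [] = mat 1"
| "cmat B (w @ [k]) = (\<chi> i j.
     if j = k then - (cmat B w $ i $ k)
     else cmat B w $ i $ j + cmat B w $ i $ k * max (bmat B w $ k $ j) 0
          + max (- (cmat B w $ i $ k)) 0 * bmat B w $ k $ j)"
  by (auto, metis rev_exhaust)
termination by lexicographic_order

function gmat :: "real^3^3 \<Rightarrow> 3 list \<Rightarrow> real^3^3" where
  "gmat B [] = mat 1"
| "gmat B (w @ [k]) = (\<chi> i j.
     if j = k then - (gmat B w $ i $ k)
          + (\<Sum>l\<in>UNIV. gmat B w $ i $ l * max (- (bmat B w $ l $ k)) 0)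
          - (\<Sum>l\<in>UNIV. bmat B [] $ i $ l * max (- (cmat B w $ l $ k)) 0)
     else gmat B w $ i $ j)"
  by (auto, metis rev_exhaust)
termination by lexicographic_order

definition cvec :: "real^3^3 \<Rightarrow> 3 list \<Rightarrow> 3 \<Rightarrow> real^3" where
  "cvec B w j = column j (cmat B w)"

definition gvec :: "real^3^3 \<Rightarrow> 3 list \<Rightarrow> 3 \<Rightarrow> real^3" where
  "gvec B w j = column j (gmat B w)"

definition ctilde :: "real^3^3 \<Rightarrow> real^3 \<Rightarrow> 3 list \<Rightarrow> 3 \<Rightarrow> real^3" where
  "ctilde B d w j = (d $ j) powr (- 1 / 2) *\<^sub>R cvec B w j"

definition gtilde :: "real^3^3 \<Rightarrow> real^3 \<Rightarrow> 3 list \<Rightarrow> 3 \<Rightarrow> real^3" where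
  "gtilde B d w j = (d $ j) powr (- 1 / 2) *\<^sub>R gvec B w j"

text \<open>
  The sign is well defined because the \<open>c\<close>-vectors are nonzero and sign-coherent. This, and
  the unique existence of \<open>S_index\<close>, are properties of the matrices considered here; the
  definite descriptions below are unspecified without them.
\<close>

definition csign :: "real^3^3 \<Rightarrow> 3 list \<Rightarrow> 3 \<Rightarrow> real" where
  "csign B w j = (THE e. e \<in> {1, - 1} \<and> cvec B w j \<noteq> 0 \<and> (\<forall>i. 0 \<le> e * cvec B w j $ i))"

definition K_index :: "3 list \<Rightarrow> 3" where
  "K_index w = last w"

definition S_index :: "real^3^3 \<Rightarrow> 3 list \<Rightarrow> 3" where
  "S_index B w = (THE s. s \<noteq> K_index w \<and> csign B w s \<noteq> csign B w (K_index w)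
                       \<and> csign B w s * bmat B w $ K_index w $ s < 0)"

definition T_index :: "real^3^3 \<Rightarrow> 3 list \<Rightarrow> 3" where
  "T_index B w = (THE t. t \<noteq> K_index w \<and> t \<noteq> S_index B w)"

datatype role = Role_K | Role_S | Role_T

fun role_index :: "real^3^3 \<Rightarrow> role \<Rightarrow> 3 list \<Rightarrow> 3" where
  "role_index B Role_K w = K_index w"
| "role_index B Role_S w = S_index B w"
| "role_index B Role_T w = T_index B w"

text \<open>The free monoid on two letters is \<open>letter list\<close>, acting on the right.\<close>

datatype letter = Letter_S | Letter_T

fun letter_step :: "real^3^3 \<Rightarrow> 3 list \<Rightarrow> letter \<Rightarrow> 3 list" where
  "letter_step B w Letter_S = w @ [S_index B w]"
| "letter_step B w Letter_T = w @ [T_index B w]"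

definition act :: "real^3^3 \<Rightarrow> 3 list \<Rightarrow> letter list \<Rightarrow> 3 list" where
  "act B w X = foldl (letter_step B) w X"

definition in_trunk :: "real^3^3 \<Rightarrow> 3 list \<Rightarrow> bool" where
  "in_trunk B w \<longleftrightarrow> (\<exists>i n. w = act B [i] (replicate n Letter_S))"

definition in_branch :: "real^3^3 \<Rightarrow> 3 list \<Rightarrow> bool" where
  "in_branch B w \<longleftrightarrow> (\<exists>i X. w = act B [i] X \<and> Letter_T \<in> set X)"

definition admissible :: "real^3^3 \<Rightarrow> 3 list \<Rightarrow> 3 list \<Rightarrow> bool" where
  "admissible B w u \<longleftrightarrow> (in_trunk B w \<and> in_trunk B u) \<or> (in_branch B w \<and> in_branch B u)"

end

theory Submission
  imports Defs
begin

text \<open>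
  After the rescaling by \<open>d\<^sub>j\<^sup>-\<^sup>1\<^sup>/\<^sup>2\<close> the exchange matrix becomes, up to the alternating sign, twice the
  cyclic orientation of \<open>{1,2,3}\<close>: the hypotheses \<open>p p' = q q' = r r' = 4\<close> say that the product of
  opposite entries is \<open>-4\<close>, and skew-symmetrizability distributes this evenly (lemma
  \<open>markov_entry_symmetrized\<close>). The modified vectors therefore obey the mutation rules of the
  Markov quiver, whatever the parameters are.

  If \<open>c\<^sub>k\<close> has a sign, mutation at \<open>k\<close> replaces \<open>c\<^sub>k\<close> by \<open>-c\<^sub>k\<close>, adds \<open>2 c\<^sub>k\<close> to exactly one of the two other
  vectors, say \<open>c\<^sub>a\<close>, and replaces \<open>g\<^sub>k\<close> by \<open>2 g\<^sub>a - g\<^sub>k\<close> (lemma \<open>mutation\<close>). For a negative \<open>c\<^sub>k\<close> the rule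
  for \<open>g\<close> refers to the initial matrix, and the duality \<open>G B\<^sup>w = B C\<close> is carried along to remove
  this reference.

  What remains is to know the signs. Ordered by their roles \<open>(K, S, T)\<close>, they have one of two patterns up to
  a global sign: \<open>(-, +, +)\<close> in a trunk, \<open>(+, -, +)\<close> in a branch. The letter
  \<open>S\<close> keeps the pattern and the letter \<open>T\<close> always leads to the second one (lemma \<open>config_step\<close>). The
  role-ordered triples of \<open>c\<close>- and \<open>g\<close>-vectors are thus transformed by each letter through a fixed
  linear recurrence that depends on the letter and on the pattern only. These recurrences commute with linear maps
  applied to all three vectors and preserve linear independence, so the linear isomorphism that carries the
  triple at \<open>w\<close> to the triple at \<open>u\<close> carries the triple at \<open>wX\<close> to the triple at \<open>uX\<close> for every \<open>X\<close>.
\<close>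

section \<open>The cyclic orientation of three indices\<close>

text \<open>
  The sign matrix of the Markov quiver: addition in the index type \<open>3\<close> is modulo three, so \<open>i + 1\<close> is the
  cyclic successor of \<open>i\<close>.
\<close>
definition orient :: "3 \<Rightarrow> 3 \<Rightarrow> real" where
  "orient i j = (if i = j then 0 else if j = i + 1 then -1 else 1)"

lemma orient_values:
  "orient 1 1 = 0" "orient 2 2 = 0" "orient 3 3 = 0"
  "orient 1 2 = -1" "orient 2 3 = -1" "orient 3 1 = -1"
  "orient 2 1 = 1" "orient 3 2 = 1" "orient 1 3 = 1"
  by (simp_all add: orient_def)

lemma orient_cyclic:
  assumes "k \<noteq> a" "a \<noteq> b" "b \<noteq> k"
  shows "orient a b = orient k a" "orient b k = orient k a" "orient a k = - orient k a"
   "orient b a = - orient k a" "orient k b = - orient k a" "\<bar>orient k a\<bar> = 1"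
proof -
  have "\<forall>k a b. k \<noteq> a \<longrightarrow> a \<noteq> b \<longrightarrow> b \<noteq> k \<longrightarrow>
   orient a b = orient k a \<and> orient b k = orient k a \<and> orient a k = - orient k a 
   \<and> orient b a = - orient k a \<and> orient k b = - orient k a \<and> \<bar>orient k a\<bar> = 1"
    unfolding forall_3 by (simp add: orient_values)
  with assms show "orient a b = orient k a" "orient b k = orient k a" "orient a k = - orient k a"
   "orient b a = - orient k a" "orient k b = - orient k a" "\<bar>orient k a\<bar> = 1" by blast+
qed

lemma UNIV_distinct3:
  assumes "k \<noteq> a" "a \<noteq> b" "b \<noteq> (k::3)"
  shows "UNIV = {k, a, b}"
proof (rule card_subset_eq[symmetric])
  show "card {k, a, b} = card (UNIV :: 3 set)" using assms by simp
qed auto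

lemma sum_distinct3:
  fixes f :: "3 \<Rightarrow> 'a::comm_monoid_add"
  assumes "k \<noteq> a" "a \<noteq> b" "b \<noteq> k"
  shows "sum f UNIV = f k + f a + f b"
proof -
  have "sum f UNIV = sum f {k,a,b}" by (simp only: UNIV_distinct3[OF assms])
  also have "\<dots> = f k + f a + f b" using assms by (auto simp: add.assoc)
  finally show ?thesis .
qed

lemma index_of_orientation:
  assumes "\<bar>e\<bar> = 1"
  obtains s t where "i \<noteq> s" "s \<noteq> t" "t \<noteq> i" "orient i s = e"
proof -
  have "\<forall>i. i \<noteq> i + 1 \<and> i + 1 \<noteq> i + 2 \<and> i + 2 \<noteq> i \<and> orient i (i + 1) = -1 \<and> orient i (i + 2) = 1"
    unfolding forall_3 by (simp add: orient_def)
  hence *: "i \<noteq> i + 1" "i + 1 \<noteq> i + 2" "i + 2 \<noteq> i" "orient i (i + 1) = -1" "orient i (i + 2) = 1"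
    by blast+
  have "e = 1 \<or> e = -1" using assms by linarith
  thus ?thesis
    using that[of "i + 1" "i + 2"] that[of "i + 2" "i + 1"] * by (metis (no_types))
qed

text \<open>
  Comparing \<open>d\<^sub>i b\<^sub>i\<^sub>j = - d\<^sub>j b\<^sub>j\<^sub>i\<close> with \<open>b\<^sub>i\<^sub>j b\<^sub>j\<^sub>i = -4\<close> gives \<open>d\<^sub>i b\<^sub>i\<^sub>j\<^sup>2 = 4 d\<^sub>j\<close>, so conjugation by the square root of
  \<open>D\<close> turns every off-diagonal entry into \<open>\<plusminus>2\<close>.
\<close>

lemma markov_entry_symmetrized:
  fixes p p' q q' r r' \<sigma> :: real and B :: "real^3^3" and d :: "real^3"
  assumes pos: "p > 0" "p' > 0" "q > 0" "q' > 0" "r > 0" "r' > 0"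
    and pr: "p * p' = 4" "q * q' = 4" "r * r' = 4"
    and sg: "\<sigma> \<in> {1, - 1}"
    and B: "B = \<sigma> *\<^sub>R vector [vector [0, - p', r], vector [p, 0, - q'], vector [- r', q, 0]]"
    and d: "\<And>i. d $ i > 0"
    and sk: "skew_symmetric (diag_mat d ** B)"
  shows "B $ i $ j * (d $ j) powr (-1/2) = (d $ i) powr (-1/2) * (2 * \<sigma> * orient i j)"
proof -
  \<comment> \<open>the absolute values of the off-diagonal entries\<close>
  define \<beta> :: "3 \<Rightarrow> 3 \<Rightarrow> real" where "\<beta> i j = \<sigma> * orient i j * B $ i $ j" for i j
  have DB: "(diag_mat d ** B) $ i $ j = d $ i * B $ i $ j" for i j
  proof -
    have "(diag_mat d ** B) $ i $ j = (\<Sum>k\<in>UNIV. (if i = k then d $ i else 0) * B $ k $ j)"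
      by (simp add: diag_mat_def matrix_matrix_mult_def)
    also have "\<dots> = (\<Sum>k\<in>UNIV. if i = k then d $ i * B $ i $ j else 0)"
      by (rule sum.cong) auto
    finally show ?thesis by simp
  qed
  have skew: "d $ i * B $ i $ j = - (d $ j * B $ j $ i)" for i j
  proof -
    have "transpose (diag_mat d ** B) $ j $ i = (- (diag_mat d ** B)) $ j $ i"
      using sk by (simp only: skew_symmetric_def)
    thus ?thesis by (simp add: transpose_def DB)
  qed
  have b: "B$1$1 = 0" "B$2$2 = 0" "B$3$3 = 0" "B$1$2 = -\<sigma>*p'" "B$1$3 = \<sigma>*r" "B$2$1 = \<sigma>*p"
     "B$2$3 = -\<sigma>*q'" "B$3$1 = -\<sigma>*r'" "B$3$2 = \<sigma>*q" by (simp_all add: B)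
  have \<sigma>: "\<sigma> * \<sigma> = 1" using sg by auto
  hence \<sigma>': "\<sigma> * (\<sigma> * x) = x" for x by (metis mult.assoc mult_1)
  have oo: "\<forall>i j. (i \<noteq> j \<longrightarrow> orient i j * orient i j = 1 \<and> orient j i = - orient i j) \<and> orient i i = 0"
    unfolding forall_3 by (simp add: orient_values)
  have "\<forall>i j. B $ i $ j = \<sigma> * orient i j * \<beta> i j"
    unfolding forall_3 by (simp add: \<beta>_def b orient_values \<sigma>' algebra_simps)
  hence B\<beta>: "B $ i $ j = \<sigma> * orient i j * \<beta> i j" for i j by blast
  show ?thesis
  proof (cases "i = j")
    case True thus ?thesis using oo by (simp add: B\<beta>)
  next
    case False
    have "\<forall>i j. i \<noteq> j \<longrightarrow> \<beta> i j > 0 \<and> \<beta> i j * \<beta> j i = 4"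
      unfolding forall_3 using pos pr by (simp add: \<beta>_def b orient_values \<sigma>' mult.commute)
    with False have \<beta>: "\<beta> i j > 0" "\<beta> i j * \<beta> j i = 4" by blast+
    have o: "orient i j * orient i j = 1" "orient j i = - orient i j" using oo False by blast+
    have "\<sigma> * orient i j * (d $ i * \<beta> i j - d $ j * \<beta> j i) = 0"
      using skew[of i j] unfolding B\<beta>[of i j] B\<beta>[of j i] o(2) by (simp add: algebra_simps)
    hence "d $ i * \<beta> i j = d $ j * \<beta> j i" using o(1) \<sigma> by auto
    hence "d $ i * (\<beta> i j)^2 = 4 * d $ j" using \<beta>(2)
      by (metis mult.assoc mult.commute power2_eq_square)
    hence "sqrt (d $ i) * \<beta> i j = 2 * sqrt (d $ j)"
      using \<beta>(1) by (metis abs_of_pos real_sqrt_mult real_sqrt_abs real_sqrt_four)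
    hence "\<beta> i j * (d $ j) powr (-1/2) = 2 * (d $ i) powr (-1/2)"
      using d[of i] d[of j] by (simp add: powr_minus powr_half_sqrt field_simps)
    thus ?thesis by (simp add: B\<beta> algebra_simps)
  qed
qed

section \<open>Linear recurrences on triples of vectors\<close>

text \<open>Triples list vectors in the order of the roles \<open>K\<close>, \<open>S\<close>, \<open>T\<close>.\<close>

type_synonym triple = "(real^3) \<times> (real^3) \<times> (real^3)"

fun frame :: "triple \<Rightarrow> bool" where
  "frame (x, y, z) \<longleftrightarrow>
     (\<forall>\<alpha> \<beta> \<gamma> :: real. \<alpha> *\<^sub>R x + \<beta> *\<^sub>R y + \<gamma> *\<^sub>R z = 0 \<longrightarrow> \<alpha> = 0 \<and> \<beta> = 0 \<and> \<gamma> = 0)"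

fun map_triple :: "(real^3 \<Rightarrow> real^3) \<Rightarrow> triple \<Rightarrow> triple" where
  "map_triple \<Phi> (x, y, z) = (\<Phi> x, \<Phi> y, \<Phi> z)"

text \<open>
  The Boolean says whether the sequence that is extended lies in a branch. The roles are reassigned
  after each mutation: the new \<open>K\<close> is the mutated index, and the new \<open>S\<close> is the index whose \<open>c\<close>-vector has changed
  with it.
\<close>

fun c_step :: "bool \<Rightarrow> letter \<Rightarrow> triple \<Rightarrow> triple" where
  "c_step br Letter_S (x, y, z) = (- y, x + 2 *\<^sub>R y, z)"
| "c_step False Letter_T (x, y, z) = (- z, y + 2 *\<^sub>R z, x)"
| "c_step True Letter_T (x, y, z) = (- z, x + 2 *\<^sub>R z, y)"

fun g_step :: "bool \<Rightarrow> letter \<Rightarrow> triple \<Rightarrow> triple" where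
  "g_step br Letter_S (x, y, z) = (2 *\<^sub>R x - y, x, z)"
| "g_step False Letter_T (x, y, z) = (2 *\<^sub>R y - z, y, x)"
| "g_step True Letter_T (x, y, z) = (2 *\<^sub>R x - z, x, y)"

fun iterate_step :: "(bool \<Rightarrow> letter \<Rightarrow> triple \<Rightarrow> triple) \<Rightarrow> bool \<Rightarrow> letter list \<Rightarrow> triple \<Rightarrow> triple" where
  "iterate_step f br [] v = v"
| "iterate_step f br (l # X) v = iterate_step f (br \<or> l = Letter_T) X (f br l v)"

lemma frame_nonzero:
  assumes "frame (x, y, z)" shows "x \<noteq> 0" "y \<noteq> 0" "z \<noteq> 0"
proof -
  from assms have *: "\<alpha> *\<^sub>R x + \<beta> *\<^sub>R y + \<gamma> *\<^sub>R z = 0 \<Longrightarrow> \<alpha> = 0 \<and> \<beta> = 0 \<and> \<gamma> = 0" for \<alpha> \<beta> \<gamma> by simp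
  show "x \<noteq> 0" "y \<noteq> 0" "z \<noteq> 0" using *[of 1 0 0] *[of 0 1 0] *[of 0 0 1] by auto
qed

text \<open>
  The two shears below, applied after a permutation, are all the steps that occur, which is why they suffice
  for the preservation of independence.
\<close>

lemma frame_shear:
  assumes "frame (x, y, z)"
  shows "frame (- y, x + 2 *\<^sub>R y, z)" "frame (2 *\<^sub>R x - y, x, z)"
proof -
  from assms have *: "\<alpha> *\<^sub>R x + \<beta> *\<^sub>R y + \<gamma> *\<^sub>R z = 0 \<Longrightarrow> \<alpha> = 0 \<and> \<beta> = 0 \<and> \<gamma> = 0" for \<alpha> \<beta> \<gamma> by simp
  show "frame (- y, x + 2 *\<^sub>R y, z)"
    unfolding frame.simps
  proof (intro allI impI)
    fix \<alpha> \<beta> \<gamma> :: real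
    assume "\<alpha> *\<^sub>R (- y) + \<beta> *\<^sub>R (x + 2 *\<^sub>R y) + \<gamma> *\<^sub>R z = 0"
    hence "\<beta> *\<^sub>R x + (2 * \<beta> - \<alpha>) *\<^sub>R y + \<gamma> *\<^sub>R z = 0" by (simp add: algebra_simps)
    from *[OF this] show "\<alpha> = 0 \<and> \<beta> = 0 \<and> \<gamma> = 0" by simp
  qed
  show "frame (2 *\<^sub>R x - y, x, z)"
    unfolding frame.simps
  proof (intro allI impI)
    fix \<alpha> \<beta> \<gamma> :: real
    assume "\<alpha> *\<^sub>R (2 *\<^sub>R x - y) + \<beta> *\<^sub>R x + \<gamma> *\<^sub>R z = 0"
    hence "(2 * \<alpha> + \<beta>) *\<^sub>R x + (- \<alpha>) *\<^sub>R y + \<gamma> *\<^sub>R z = 0" by (simp add: algebra_simps)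
    from *[OF this] show "\<alpha> = 0 \<and> \<beta> = 0 \<and> \<gamma> = 0" by simp
  qed
qed

lemma frame_permute:
  assumes "frame (x, y, z)"
  shows "frame (y, z, x)" "frame (x, z, y)"
proof -
  from assms have *: "\<alpha> *\<^sub>R x + \<beta> *\<^sub>R y + \<gamma> *\<^sub>R z = 0 \<Longrightarrow> \<alpha> = 0 \<and> \<beta> = 0 \<and> \<gamma> = 0" for \<alpha> \<beta> \<gamma> by simp
  show "frame (y, z, x)"
    unfolding frame.simps
  proof (intro allI impI)
    fix \<alpha> \<beta> \<gamma> :: real
    assume "\<alpha> *\<^sub>R y + \<beta> *\<^sub>R z + \<gamma> *\<^sub>R x = 0"
    hence "\<gamma> *\<^sub>R x + \<alpha> *\<^sub>R y + \<beta> *\<^sub>R z = 0" by (simp add: ac_simps)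
    from *[OF this] show "\<alpha> = 0 \<and> \<beta> = 0 \<and> \<gamma> = 0" by simp
  qed
  show "frame (x, z, y)"
    unfolding frame.simps
  proof (intro allI impI)
    fix \<alpha> \<beta> \<gamma> :: real
    assume "\<alpha> *\<^sub>R x + \<beta> *\<^sub>R z + \<gamma> *\<^sub>R y = 0"
    hence "\<alpha> *\<^sub>R x + \<gamma> *\<^sub>R y + \<beta> *\<^sub>R z = 0" by (simp add: ac_simps)
    from *[OF this] show "\<alpha> = 0 \<and> \<beta> = 0 \<and> \<gamma> = 0" by simp
  qed
qed

lemma frame_step:
  assumes "frame v"
  shows "frame (c_step br l v)" "frame (g_step br l v)"
proof -
  obtain x y z where v: "v = (x, y, z)" by (cases v)
  note f = assms[unfolded v]
  note perm = f frame_permute[OF f]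
  show "frame (c_step br l v)"
    unfolding v by (cases br; cases l) (simp_all only: c_step.simps frame_shear(1)[OF perm(1)]
      frame_shear(1)[OF perm(2)] frame_shear(1)[OF perm(3)])
  show "frame (g_step br l v)"
    unfolding v by (cases br; cases l) (simp_all only: g_step.simps frame_shear(2)[OF perm(1)]
      frame_shear(2)[OF perm(2)] frame_shear(2)[OF perm(3)])
qed

lemma step_linear:
  assumes "linear \<Phi>"
  shows "c_step br l (map_triple \<Phi> v) = map_triple \<Phi> (c_step br l v)"
    and "g_step br l (map_triple \<Phi> v) = map_triple \<Phi> (g_step br l v)"
  by (cases v; cases br; cases l;
      simp add: linear_add[OF assms] linear_diff[OF assms] linear_scale[OF assms] linear_neg[OF assms])+

text \<open>
  This commutation is what makes one linear map serve for all words at once.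
\<close>

lemma iterate_step_commute:
  assumes "\<And>br l v. f br l (map_triple \<Phi> v) = map_triple \<Phi> (f br l v)"
  shows "iterate_step f br X (map_triple \<Phi> v) = map_triple \<Phi> (iterate_step f br X v)"
  by (induction X arbitrary: br v) (simp_all add: assms)

text \<open>Any two bases differ by an automorphism; it factors through the standard basis.\<close>

lemma frame_transition:
  assumes "frame v" "frame v'"
  obtains \<Phi> where "linear \<Phi>" "bij \<Phi>" "map_triple \<Phi> v = v'"
proof -
  have *: "\<exists>f. linear f \<and> bij f \<and> map_triple f (axis 1 1, axis 2 1, axis 3 1) = v" if "frame v" for v
  proof -
    obtain x y z where v: "v = (x, y, z)" by (cases v)
    define f :: "real^3 \<Rightarrow> real^3" where "f a = (a $ 1) *\<^sub>R x + (a $ 2) *\<^sub>R y + (a $ 3) *\<^sub>R z" for a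
    have lin: "linear f" by (rule linearI) (simp_all add: f_def algebra_simps)
    have "inj f" unfolding linear_injective_0[OF lin]
      using that unfolding v f_def frame.simps vec_eq_iff forall_3 by (metis zero_index)
    hence "bij f" using linear_injective_imp_surjective[OF lin] by (simp add: bij_def)
    moreover have "map_triple f (axis 1 1, axis 2 1, axis 3 1) = v" by (simp add: v f_def axis_def)
    ultimately show ?thesis using lin by blast
  qed
  obtain f where f: "linear f" "bij f" "map_triple f (axis 1 1, axis 2 1, axis 3 1) = v"
    using *[OF assms(1)] by blast
  obtain h where h: "linear h" "bij h" "map_triple h (axis 1 1, axis 2 1, axis 3 1) = v'"
    using *[OF assms(2)] by blast
  have inv: "inv f (f a) = a" for a using f(2) by (simp add: bij_is_inj)
  have "linear (inv f)" 
    using f(1,2) linear_injective_left_inverse by (metis bij_def inj_linear_imp_inv_linear)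
  hence "linear (h \<circ> inv f)" using h(1) by (rule linear_compose)
  moreover have "bij (h \<circ> inv f)" using f(2) h(2) by (simp add: bij_comp bij_imp_bij_inv)
  moreover have "map_triple (h \<circ> inv f) v = v'"
    unfolding f(3)[symmetric] h(3)[symmetric] by (simp add: inv)
  ultimately show ?thesis using that by blast
qed

section \<open>Mutation of the modified vectors\<close>

text \<open>
  Passing to the symmetrized entries makes the three indices interchangeable up to orientation, so no
  argument below distinguishes between them.
\<close>

locale symmetrized =
  fixes B :: "real^3^3" and d :: "real^3" and \<sigma> :: real
  assumes d_pos: "d $ i > 0" and sigma: "\<bar>\<sigma>\<bar> = 1"
    and entry: "B $ i $ j * (d $ j) powr (-1/2) = (d $ i) powr (-1/2) * (2 * \<sigma> * orient i j)"
begin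

abbreviation "\<delta> j \<equiv> (d $ j) powr (-1/2)"
abbreviation "c \<equiv> ctilde B d"
abbreviation "g \<equiv> gtilde B d"

text \<open>
  The sign of \<open>b\<^sub>i\<^sub>j\<^sup>w\<close>; the symmetrized entry is \<open>2 * ori w i j\<close>.
\<close>

definition ori :: "3 list \<Rightarrow> 3 \<Rightarrow> 3 \<Rightarrow> real" where
  "ori w i j = (-1) ^ length w * \<sigma> * orient i j"

lemma \<delta>_pos: "\<delta> j > 0" using d_pos[of j] by simp

lemma bmat_entry: "bmat B w $ i $ j * \<delta> j = \<delta> i * (2 * ori w i j)"
  using entry[of i j] by (simp add: bmat_def ori_def mult.assoc mult.left_commute)

lemma ori_snoc: "ori (w @ [k]) i j = - ori w i j"
  by (simp add: ori_def)

lemma ori_cyclic: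
  assumes "k \<noteq> a" "a \<noteq> b" "b \<noteq> k"
  shows "ori w a b = ori w k a" "ori w b k = ori w k a" "ori w a k = - ori w k a"
   "ori w b a = - ori w k a" "ori w k b = - ori w k a" "\<bar>ori w k a\<bar> = 1"
  using orient_cyclic[OF assms] sigma by (simp_all add: ori_def abs_mult power_abs)

lemma ori_same: "ori w k k = 0"
  by (simp add: ori_def orient_def)

text \<open>
  The factor \<open>\<delta> j\<close> can be moved inside the maxima because it is positive; there it exchanges \<open>b\<^sub>k\<^sub>j\<close> for the
  symmetrized entry and \<open>\<delta> k\<close>.
\<close>

lemma c_mutation:
  "c (w @ [k]) j $ i = (if j = k then - c w k $ i
     else c w j $ i + c w k $ i * max (2 * ori w k j) 0 + max (- c w k $ i) 0 * (2 * ori w k j))"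
proof (cases "j = k")
  case True thus ?thesis by (simp add: ctilde_def cvec_def column_def)
next
  case False
  let ?b = "bmat B w $ k $ j" and ?c = "cmat B w $ i $ k"
  have m: "x * max y 0 = max (x * y) 0" "max y 0 * x = max (y * x) 0" if "x > 0" for x y :: real
    using that by (auto simp: max_def mult_less_0_iff zero_le_mult_iff not_le mult_le_0_iff)
  have "c (w @ [k]) j $ i = \<delta> j * (cmat B w $ i $ j) + ?c * (max ?b 0 * \<delta> j) + max (- ?c) 0 * (?b * \<delta> j)"
    using False by (simp add: ctilde_def cvec_def column_def algebra_simps)
  also have "max ?b 0 * \<delta> j = \<delta> k * max (2 * ori w k j) 0"
    unfolding m(1)[OF \<delta>_pos] m(2)[OF \<delta>_pos] bmat_entry ..
  also have "max (- ?c) 0 * (?b * \<delta> j) = max (- (\<delta> k * ?c)) 0 * (2 * ori w k j)"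
    unfolding bmat_entry using m(1)[OF \<delta>_pos[of k], of "- ?c"]
    by (simp only: mult.assoc[symmetric] mult.commute[of _ "\<delta> k"]) simp
  finally show ?thesis using False by (simp add: ctilde_def cvec_def column_def)
qed

lemma g_mutation_same:
  "g (w @ [k]) k $ i = - g w k $ i + (\<Sum>l\<in>UNIV. g w l $ i * max (- (2 * ori w l k)) 0)
          - (\<Sum>l\<in>UNIV. B $ i $ l * max (- c w k $ l) 0)"
proof -
  have m: "x * max y 0 = max (x * y) 0" if "x > 0" for x y :: real
    using that by (auto simp: max_def mult_less_0_iff zero_le_mult_iff not_le mult_le_0_iff)
  have 1: "\<delta> k * max (- (bmat B w $ l $ k)) 0 = \<delta> l * max (- (2 * ori w l k)) 0" for l
    unfolding m[OF \<delta>_pos] using bmat_entry[of w l k] by (simp add: mult.commute)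
  have 2: "\<delta> k * max (- (cmat B w $ l $ k)) 0 = max (- c w k $ l) 0" for l
    unfolding m[OF \<delta>_pos] by (simp add: ctilde_def cvec_def column_def)
  have "g (w @ [k]) k $ i = - g w k $ i
      + (\<Sum>l\<in>UNIV. gmat B w $ i $ l * (\<delta> k * max (- (bmat B w $ l $ k)) 0))
      - (\<Sum>l\<in>UNIV. B $ i $ l * (\<delta> k * max (- (cmat B w $ l $ k)) 0))"
    by (simp add: gtilde_def gvec_def column_def bmat_def sum_distrib_left right_diff_distrib
        distrib_left mult.left_commute)
  thus ?thesis unfolding 1 2
    by (simp add: gtilde_def gvec_def column_def mult.assoc mult.left_commute)
qed

lemma g_mutation_other: "j \<noteq> k \<Longrightarrow> g (w @ [k]) j = g w j"
  by (simp add: gtilde_def gvec_def column_def vec_eq_iff)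

text \<open>
  The duality \<open>G B\<^sup>w = B C\<close>, read column by column. In the column of \<open>k\<close> the coefficients of the
  other two \<open>g\<close>-vectors are opposite, so they combine to a difference.
\<close>

definition dual :: "3 list \<Rightarrow> bool" where
  "dual w \<longleftrightarrow> (\<forall>k a b. k \<noteq> a \<longrightarrow> a \<noteq> b \<longrightarrow> b \<noteq> k \<longrightarrow>
     B *v c w k = (2 * ori w k a) *\<^sub>R (g w b - g w a))"

text \<open>
  Exchanging \<open>a\<close> and \<open>b\<close> changes both factors of the right-hand side by a sign, so one
  of the two cyclic orders of the indices is enough.
\<close>

lemma dualI:
  assumes abc: "k \<noteq> a" "a \<noteq> b" "b \<noteq> k"
    and "B *v c w k = (2 * ori w k a) *\<^sub>R (g w b - g w a)"
    and "B *v c w a = (2 * ori w k a) *\<^sub>R (g w k - g w b)"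
    and "B *v c w b = (2 * ori w k a) *\<^sub>R (g w a - g w k)"
  shows "dual w"
  unfolding dual_def
proof (intro allI impI)
  fix x y z assume d: "x \<noteq> y" "y \<noteq> z" "z \<noteq> (x::3)"
  have "x \<in> {k,a,b}" "y \<in> {k,a,b}" "z \<in> {k,a,b}" using UNIV_distinct3[OF abc] by blast+
  then consider "x = k" "y = a" "z = b" | "x = k" "y = b" "z = a" | "x = a" "y = k" "z = b"
    | "x = a" "y = b" "z = k" | "x = b" "y = k" "z = a" | "x = b" "y = a" "z = k" using d by blast
  thus "B *v c w x = (2 * ori w x y) *\<^sub>R (g w z - g w y)"
    by cases (simp_all add: assms(4-) ori_cyclic[OF abc] algebra_simps)
qed

lemma initial_vectors: "c [] j = \<delta> j *\<^sub>R axis j 1" "g [] j = \<delta> j *\<^sub>R axis j 1"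
  by (simp_all add: ctilde_def gtilde_def cvec_def gvec_def column_def mat_def axis_def vec_eq_iff)

lemma dual_initial: "dual []"
  unfolding dual_def
proof (intro allI impI)
  fix k a b assume d: "k \<noteq> a" "a \<noteq> b" "b \<noteq> (k::3)"
  have col: "(B *v c [] k) $ i = \<delta> i * (2 * ori [] i k)" for i
    using entry[of i k]
    by (simp add: initial_vectors matrix_vector_mult_scaleR matrix_vector_mult_basis column_def ori_def
       mult.commute)
  have "(B *v c [] k) $ i = ((2 * ori [] k a) *\<^sub>R (g [] b - g [] a)) $ i" for i
  proof -
    consider "i = k" | "i = a" | "i = b" using UNIV_distinct3[OF d] by blast
    thus ?thesis
      unfolding col
      by cases (use d in \<open>simp_all add: initial_vectors axis_def ori_cyclic[OF d] ori_same\<close>)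
  qed
  thus "B *v c [] k = (2 * ori [] k a) *\<^sub>R (g [] b - g [] a)" by (simp add: vec_eq_iff)
qed

text \<open>
  For \<open>e = 1\<close> the truncated terms built from \<open>c\<^sub>k\<close> vanish and the rules reduce to the claim. For \<open>e = -1\<close> they
  equal \<open>-c\<^sub>k\<close>, which changes \<open>max b 0\<close> into \<open>max (-b) 0\<close> in the rule for \<open>c\<close> and contributes \<open>B c\<^sub>k\<close> in the
  rule for \<open>g\<close>; duality rewrites the latter by \<open>g\<close>-vectors. In both cases \<open>a\<close> is the only index with
  \<open>e b\<^sub>k\<^sub>a > 0\<close>.
\<close>

lemma mutation:
  assumes abc: "k \<noteq> a" "a \<noteq> b" "b \<noteq> k"
    and e: "ori w k a = e" and pos: "\<And>i. 0 \<le> e * c w k $ i" and dual: "dual w"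
  shows "c (w @ [k]) k = - c w k" "c (w @ [k]) a = c w a + 2 *\<^sub>R c w k" "c (w @ [k]) b = c w b"
    "g (w @ [k]) k = 2 *\<^sub>R g w a - g w k" "g (w @ [k]) a = g w a" "g (w @ [k]) b = g w b"
    "dual (w @ [k])"
proof -
  have e1: "e = 1 \<or> e = -1" using ori_cyclic(6)[OF abc, of w] e by linarith
  have d1: "B *v c w k = (2 * e) *\<^sub>R (g w b - g w a)" 
    using dual abc e unfolding dual_def by blast
  have d2: "B *v c w a = (2 * e) *\<^sub>R (g w k - g w b)" 
    using dual abc ori_cyclic[OF abc] e unfolding dual_def by metis
  have d3: "B *v c w b = (2 * e) *\<^sub>R (g w a - g w k)" 
    using dual abc ori_cyclic[OF abc] e unfolding dual_def by metis
  show ck: "c (w @ [k]) k = - c w k" by (simp add: vec_eq_iff c_mutation)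
  show ca: "c (w @ [k]) a = c w a + 2 *\<^sub>R c w k"
    unfolding vec_eq_iff
  proof
    fix i show "c (w @ [k]) a $ i = (c w a + 2 *\<^sub>R c w k) $ i"
      using e1 pos[of i] abc e by (auto simp: c_mutation)
  qed
  show cb: "c (w @ [k]) b = c w b"
    unfolding vec_eq_iff
  proof
    fix i show "c (w @ [k]) b $ i = c w b $ i"
      using e1 pos[of i] abc e by (auto simp: c_mutation ori_cyclic[OF abc])
  qed
  show ga: "g (w @ [k]) a = g w a" and gb: "g (w @ [k]) b = g w b"
    using abc by (auto intro: g_mutation_other)
  show gk: "g (w @ [k]) k = 2 *\<^sub>R g w a - g w k"
    unfolding vec_eq_iff
  proof
    fix i
    show "g (w @ [k]) k $ i = (2 *\<^sub>R g w a - g w k) $ i"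
    proof (cases "e = 1")
      case True
      hence "max (- c w k $ l) 0 = 0" for l using pos[of l] by simp
      thus ?thesis using True e
        by (simp add: g_mutation_same sum_distinct3[OF abc] ori_cyclic[OF abc] ori_same)
    next
      case False
      hence e': "e = -1" using e1 by simp
      hence "max (- c w k $ l) 0 = - c w k $ l" for l using pos[of l] by simp
      hence "(\<Sum>l\<in>UNIV. B $ i $ l * max (- c w k $ l) 0) = - (B *v c w k) $ i"
        by (simp add: matrix_vector_mult_def sum_negf)
      thus ?thesis using e' e d1
        by (simp add: g_mutation_same sum_distinct3[OF abc] ori_cyclic[OF abc] ori_same)
    qed
  qed
  have 1: "ori (w @ [k]) k a = - e" using e by (simp add: ori_snoc)
  show "dual (w @ [k])"
  proof (rule dualI[OF abc], unfold 1 ck ca cb gk ga gb)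
    show "B *v - c w k = (2 * - e) *\<^sub>R (g w b - g w a)"
      using d1 matrix_vector_mult_scaleR[of B "-1" "c w k"] by simp
    show "B *v (c w a + 2 *\<^sub>R c w k) = (2 * - e) *\<^sub>R (2 *\<^sub>R g w a - g w k - g w b)"
      unfolding matrix_vector_right_distrib matrix_vector_mult_scaleR d1 d2
      by (simp add: vec_eq_iff algebra_simps)
    show "B *v c w b = (2 * - e) *\<^sub>R (g w a - (2 *\<^sub>R g w a - g w k))"
      unfolding d3 by (simp add: vec_eq_iff algebra_simps)
  qed
qed


section \<open>Sign patterns along words\<close>

text \<open>
  The invariant of the induction: \<open>e\<close> is the sign of \<open>c\<^sub>K\<close>, the vector \<open>c\<^sub>S\<close> has the opposite sign, and \<open>c\<^sub>T\<close> has the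
  sign of \<open>c\<^sub>K\<close> in a branch and of \<open>c\<^sub>S\<close> in a trunk. The condition on \<open>c\<^sub>K + c\<^sub>S\<close> says that \<open>c\<^sub>S\<close> dominates; it keeps
  \<open>c\<^sub>K + 2 c\<^sub>S\<close>, the result of the letter \<open>S\<close>, at the sign of \<open>c\<^sub>S\<close>.
\<close>

definition config :: "3 list \<Rightarrow> 3 \<Rightarrow> 3 \<Rightarrow> 3 \<Rightarrow> real \<Rightarrow> bool \<Rightarrow> bool" where
  "config w k s t e br \<longleftrightarrow> w \<noteq> [] \<and> last w = k \<and> k \<noteq> s \<and> s \<noteq> t \<and> t \<noteq> k \<and> ori w k s = e \<and>
     (\<forall>i. 0 \<le> e * c w k $ i \<and> e * c w s $ i \<le> 0 \<and> e * (c w k $ i + c w s $ i) \<le> 0 \<and>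
          0 \<le> (if br then e else - e) * c w t $ i) \<and>
     dual w \<and> frame (c w k, c w s, c w t) \<and> frame (g w k, g w s, g w t)"

lemma csign_eq:
  assumes "\<bar>e\<bar> = 1" "\<And>i. 0 \<le> e * c w j $ i" "c w j \<noteq> 0"
  shows "csign B w j = e"
proof -
  have cv: "c w j $ i = \<delta> j * cvec B w j $ i" for i by (simp add: ctilde_def)
  have nz: "cvec B w j \<noteq> 0" using assms(3) by (auto simp: ctilde_def)
  then obtain i where i: "cvec B w j $ i \<noteq> 0" by (auto simp: vec_eq_iff)
  have e: "0 \<le> e * cvec B w j $ i" for i
    using assms(2)[of i] \<delta>_pos[of j] unfolding cv by (simp add: zero_le_mult_iff mult_le_0_iff)
  show ?thesis
    unfolding csign_def
  proof (rule the_equality)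
    show "e \<in> {1, - 1} \<and> cvec B w j \<noteq> 0 \<and> (\<forall>i. 0 \<le> e * cvec B w j $ i)"
      using assms(1) nz e by auto
  next
    fix e' assume e': "e' \<in> {1, - 1} \<and> cvec B w j \<noteq> 0 \<and> (\<forall>i. 0 \<le> e' * cvec B w j $ i)"
    hence nonneg: "0 \<le> e' * cvec B w j $ i" and "e' = 1 \<or> e' = - 1" by blast+
    moreover have "e = 1 \<or> e = - 1" using assms(1) by linarith
    ultimately show "e' = e" using e[of i] i by auto
  qed
qed

lemma bmat_sign: "x * bmat B w $ i $ j < 0 \<longleftrightarrow> x * ori w i j < 0"
proof -
  have "x * bmat B w $ i $ j < 0 \<longleftrightarrow> x * bmat B w $ i $ j * \<delta> j < 0"
    using \<delta>_pos[of j] by (simp add: mult_less_0_iff)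
  also have "x * bmat B w $ i $ j * \<delta> j = (2 * \<delta> i) * (x * ori w i j)"
    unfolding mult.assoc bmat_entry by simp
  also have "\<dots> < 0 \<longleftrightarrow> x * ori w i j < 0"
    using \<delta>_pos[of i] by (simp add: mult_less_0_iff)
  finally show ?thesis .
qed

text \<open>
  The sign pattern determines the roles. The index \<open>t\<close> is excluded as a candidate for \<open>S\<close>: if \<open>c\<^sub>t\<close> differs in
  sign from \<open>c\<^sub>k\<close>, then \<open>b\<^sub>k\<^sub>t\<close> has the same sign as \<open>c\<^sub>t\<close>, because \<open>b\<^sub>k\<^sub>s\<close> and \<open>b\<^sub>k\<^sub>t\<close> are opposite.
\<close>

lemma config_indices:
  assumes "config w k s t e br"
  shows "K_index w = k" "S_index B w = s" "T_index B w = t"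
proof -
  from assms have d: "k \<noteq> s" "s \<noteq> t" "t \<noteq> k" and o: "ori w k s = e" and l: "last w = k"
    and sg: "\<And>i. 0 \<le> e * c w k $ i" "\<And>i. e * c w s $ i \<le> 0"
      "\<And>i. 0 \<le> (if br then e else - e) * c w t $ i"
    and f: "frame (c w k, c w s, c w t)" unfolding config_def by blast+
  have e: "\<bar>e\<bar> = 1" using ori_cyclic(6)[OF d, of w] o by simp
  hence ee: "e * e = 1" "e \<noteq> - e" "- e \<noteq> e" by (auto simp: abs_if split: if_splits)
  have csk: "csign B w k = e" using e sg(1) frame_nonzero[OF f] by (intro csign_eq)
  have css: "csign B w s = - e" using e sg(2) frame_nonzero[OF f] by (intro csign_eq) auto
  have cst: "csign B w t = (if br then e else - e)"
    using e sg(3) frame_nonzero[OF f] by (intro csign_eq) auto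
  show K: "K_index w = k" using l by (simp add: K_index_def)
  show S: "S_index B w = s"
    unfolding S_index_def K
  proof (rule the_equality)
    show "s \<noteq> k \<and> csign B w s \<noteq> csign B w k \<and> csign B w s * bmat B w $ k $ s < 0"
      unfolding bmat_sign csk css o using d ee by simp
  next
    fix j assume j: "j \<noteq> k \<and> csign B w j \<noteq> csign B w k \<and> csign B w j * bmat B w $ k $ j < 0"
    have "j \<noteq> t"
    proof
      assume "j = t"
      thus False using j ee
        unfolding bmat_sign by (auto simp: csk cst o ori_cyclic[OF d] split: if_splits)
    qed
    thus "j = s" using j UNIV_distinct3[OF d] by blast
  qed
  show "T_index B w = t"
    unfolding T_index_def K S using d UNIV_distinct3[OF d] by (intro the_equality) auto
qed

text \<open>
  All initial \<open>c\<close>-vectors are positive, so the first mutation at \<open>i\<close> affects the index \<open>s\<close> with \<open>b\<^sub>i\<^sub>s > 0\<close>. Formally the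
  triple arises as from the letter \<open>T\<close> in a trunk, applied to the initial triple in the order
  \<open>t, s, i\<close>, which gives its independence.
\<close>

lemma config_initial: "\<exists>s t. config [i] i s t (-1) False"
proof -
  have "\<bar>\<sigma>\<bar> = 1" by (rule sigma)
  then obtain s t where d: "i \<noteq> s" "s \<noteq> t" "t \<noteq> i" and o: "orient i s = \<sigma>" by (rule index_of_orientation)
  have os: "ori [] i s = 1" using o sigma by (auto simp: ori_def abs_if split: if_splits)
  have pos: "0 \<le> c [] j $ l" for j l by (simp add: initial_vectors axis_def)
  have m: "c [i] i = - c [] i" "c [i] s = c [] s + 2 *\<^sub>R c [] i" "c [i] t = c [] t"
    "g [i] i = 2 *\<^sub>R g [] s - g [] i" "g [i] s = g [] s" "g [i] t = g [] t" "dual [i]"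
    using mutation[OF d os _ dual_initial] pos by simp_all
  have "frame (c [] t, c [] s, c [] i)"
    unfolding frame.simps
  proof (intro allI impI)
    fix \<alpha> \<beta> \<gamma> :: real
    assume z: "\<alpha> *\<^sub>R c [] t + \<beta> *\<^sub>R c [] s + \<gamma> *\<^sub>R c [] i = 0"
    have "(\<alpha> *\<^sub>R c [] t + \<beta> *\<^sub>R c [] s + \<gamma> *\<^sub>R c [] i) $ j = 0" for j unfolding z by simp
    from this[of t] this[of s] this[of i] show "\<alpha> = 0 \<and> \<beta> = 0 \<and> \<gamma> = 0"
      using d \<delta>_pos[of t] \<delta>_pos[of s] \<delta>_pos[of i] by (simp add: initial_vectors axis_def)
  qed
  moreover from this have "frame (g [] t, g [] s, g [] i)" by (simp only: initial_vectors)
  ultimately have "frame (c_step False Letter_T (c [] t, c [] s, c [] i))"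
    "frame (g_step False Letter_T (g [] t, g [] s, g [] i))" by (blast intro: frame_step)+
  hence "frame (c [i] i, c [i] s, c [i] t)" "frame (g [i] i, g [i] s, g [i] t)"
    unfolding c_step.simps g_step.simps m .
  note frames = this
  have "config [i] i s t (-1) False"
    unfolding config_def
  proof (intro conjI allI)
    show "ori [i] i s = -1" using os ori_snoc[of "[]" i i s] by simp
    fix l
    show "0 \<le> -1 * c [i] i $ l" "-1 * c [i] s $ l \<le> 0" "-1 * (c [i] i $ l + c [i] s $ l) \<le> 0"
      "0 \<le> (if False then -1 else - (-1)) * c [i] t $ l"
      unfolding m using pos[of i l] pos[of s l] pos[of t l] by simp_all
  qed (use d m(7) frames in simp_all)
  thus ?thesis by blast
qed

text \<open>
  The only choice in a mutation is which of the two other vectors receives the mutated one, and this is decided by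
  the sign of the mutated \<open>c\<close>-vector. Mutation at \<open>s\<close> always changes \<open>c\<^sub>k\<close>. Mutation at \<open>t\<close> changes \<open>c\<^sub>s\<close> in a
  trunk but \<open>c\<^sub>k\<close> in a branch: there \<open>c\<^sub>t\<close> shares the sign of \<open>c\<^sub>s\<close>, here that of \<open>c\<^sub>k\<close>. The
  vector changed always becomes the new \<open>S\<close>; the sign of the new \<open>c\<^sub>K\<close> flips only in the last case.
\<close>

lemma config_step:
  assumes cf: "config w k s t e br"
  shows "\<exists>k' s' t' e'. config (letter_step B w l) k' s' t' e' (br \<or> l = Letter_T) \<and>
    (c (letter_step B w l) k', c (letter_step B w l) s', c (letter_step B w l) t')
       = c_step br l (c w k, c w s, c w t) \<and>
    (g (letter_step B w l) k', g (letter_step B w l) s', g (letter_step B w l) t')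
       = g_step br l (g w k, g w s, g w t)"
proof -
  from cf have d: "k \<noteq> s" "s \<noteq> t" "t \<noteq> k" and o: "ori w k s = e"
    and sg: "\<And>i. 0 \<le> e * c w k $ i" "\<And>i. e * c w s $ i \<le> 0"
      "\<And>i. e * (c w k $ i + c w s $ i) \<le> 0"
      "\<And>i. 0 \<le> (if br then e else - e) * c w t $ i"
    and du: "dual w" and f: "frame (c w k, c w s, c w t)" "frame (g w k, g w s, g w t)"
    unfolding config_def by blast+
  have d': "s \<noteq> k" "t \<noteq> s" "k \<noteq> t" using d by auto
  note fs = frame_step(1)[OF f(1), of br l] frame_step(2)[OF f(2), of br l]
  consider (S) "l = Letter_S" | (T0) "l = Letter_T" "\<not> br" | (T1) "l = Letter_T" br
    using letter.exhaust by blast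
  thus ?thesis
  proof cases
    case S
    have os: "ori w s k = - e" using o ori_cyclic[OF d] by simp
    have m: "c (w @ [s]) s = - c w s" "c (w @ [s]) k = c w k + 2 *\<^sub>R c w s" "c (w @ [s]) t = c w t"
      "g (w @ [s]) s = 2 *\<^sub>R g w k - g w s" "g (w @ [s]) k = g w k" "g (w @ [s]) t = g w t"
      "dual (w @ [s])"
      using mutation[OF d'(1) d'(3) d'(2) os _ du] sg(2) by simp_all
    have w: "letter_step B w l = w @ [s]" using S config_indices[OF cf] by simp
    have "config (w @ [s]) s k t e br"
      unfolding config_def
    proof (intro conjI allI)
      show "ori (w @ [s]) s k = e" using os by (simp add: ori_snoc)
      show "frame (c (w @ [s]) s, c (w @ [s]) k, c (w @ [s]) t)"
        "frame (g (w @ [s]) s, g (w @ [s]) k, g (w @ [s]) t)"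
        using fs unfolding S c_step.simps g_step.simps m .
      fix i
      show "0 \<le> e * c (w @ [s]) s $ i" "e * c (w @ [s]) k $ i \<le> 0"
        "e * (c (w @ [s]) s $ i + c (w @ [s]) k $ i) \<le> 0"
        "0 \<le> (if br then e else - e) * c (w @ [s]) t $ i"
        unfolding m using sg[of i] by (simp_all add: algebra_simps)
    qed (use d d' m in auto)
    thus ?thesis
      unfolding w by (intro exI[of _ s] exI[of _ k] exI[of _ t] exI[of _ e]) (simp add: S m(1-6))
  next
    case T0
    have ot: "ori w t s = - e" using o ori_cyclic[OF d] by simp
    have m: "c (w @ [t]) t = - c w t" "c (w @ [t]) s = c w s + 2 *\<^sub>R c w t" "c (w @ [t]) k = c w k"
      "g (w @ [t]) t = 2 *\<^sub>R g w s - g w t" "g (w @ [t]) s = g w s" "g (w @ [t]) k = g w k"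
      "dual (w @ [t])"
      using mutation[OF d'(2) d'(1) d'(3) ot _ du] sg(4) T0 by simp_all
    have w: "letter_step B w l = w @ [t]" using T0 config_indices[OF cf] by simp
    have br: "br = False" using T0 by simp
    have "config (w @ [t]) t s k e True"
      unfolding config_def
    proof (intro conjI allI)
      show "ori (w @ [t]) t s = e" using ot by (simp add: ori_snoc)
      show "frame (c (w @ [t]) t, c (w @ [t]) s, c (w @ [t]) k)"
        "frame (g (w @ [t]) t, g (w @ [t]) s, g (w @ [t]) k)"
        using fs unfolding T0(1) br c_step.simps g_step.simps m .
      fix i
      show "0 \<le> e * c (w @ [t]) t $ i" "e * c (w @ [t]) s $ i \<le> 0"
        "e * (c (w @ [t]) t $ i + c (w @ [t]) s $ i) \<le> 0"
        "0 \<le> (if True then e else - e) * c (w @ [t]) k $ i"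
        unfolding m using sg[of i] br by (simp_all add: algebra_simps)
    qed (use d d' m in auto)
    thus ?thesis
      unfolding w by (intro exI[of _ t] exI[of _ s] exI[of _ k] exI[of _ e]) (simp add: T0(1) br m(1-6))
  next
    case T1
    have ot: "ori w t k = e" using o ori_cyclic[OF d] by simp
    have m: "c (w @ [t]) t = - c w t" "c (w @ [t]) k = c w k + 2 *\<^sub>R c w t" "c (w @ [t]) s = c w s"
      "g (w @ [t]) t = 2 *\<^sub>R g w k - g w t" "g (w @ [t]) k = g w k" "g (w @ [t]) s = g w s"
      "dual (w @ [t])"
      using mutation[OF d(3) d(1) d(2) ot _ du] sg(4) T1 by simp_all
    have w: "letter_step B w l = w @ [t]" using T1 config_indices[OF cf] by simp
    have br: "br = True" using T1 by simp
    have "config (w @ [t]) t k s (- e) True"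
      unfolding config_def
    proof (intro conjI allI)
      show "ori (w @ [t]) t k = - e" using ot by (simp add: ori_snoc)
      show "frame (c (w @ [t]) t, c (w @ [t]) k, c (w @ [t]) s)"
        "frame (g (w @ [t]) t, g (w @ [t]) k, g (w @ [t]) s)"
        using fs unfolding T1(1) br c_step.simps g_step.simps m .
      fix i
      show "0 \<le> - e * c (w @ [t]) t $ i" "- e * c (w @ [t]) k $ i \<le> 0"
        "- e * (c (w @ [t]) t $ i + c (w @ [t]) k $ i) \<le> 0"
        "0 \<le> (if True then - e else - (- e)) * c (w @ [t]) s $ i"
        unfolding m using sg[of i] br by (simp_all add: algebra_simps)
    qed (use d d' m in auto)
    thus ?thesis
      unfolding w by (intro exI[of _ t] exI[of _ k] exI[of _ s] exI[of _ "- e"]) (simp add: T1(1) br m(1-6))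
  qed
qed

section \<open>Triples along words and the transition maps\<close>

definition c_triple :: "3 list \<Rightarrow> triple" where
  "c_triple w = (c w (K_index w), c w (S_index B w), c w (T_index B w))"

definition g_triple :: "3 list \<Rightarrow> triple" where
  "g_triple w = (g w (K_index w), g w (S_index B w), g w (T_index B w))"

lemma triples_act:
  assumes "config w k s t e br"
  shows "(\<exists>k s t e. config (act B w X) k s t e (br \<or> Letter_T \<in> set X)) \<and>
    c_triple (act B w X) = iterate_step c_step br X (c_triple w) \<and>
    g_triple (act B w X) = iterate_step g_step br X (g_triple w)"
  using assms
proof (induction X arbitrary: w k s t e br)
  case Nil
  thus ?case by (auto simp: act_def)
next
  case (Cons l X)
  let ?w = "letter_step B w l"
  obtain k' s' t' e' where cf: "config ?w k' s' t' e' (br \<or> l = Letter_T)"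
    and eq: "(c ?w k', c ?w s', c ?w t') = c_step br l (c w k, c w s, c w t)"
      "(g ?w k', g ?w s', g ?w t') = g_step br l (g w k, g w s, g w t)"
    using config_step[OF Cons.prems, of l] by metis
  have tr: "c_triple ?w = c_step br l (c_triple w)" "g_triple ?w = g_step br l (g_triple w)"
    using eq unfolding c_triple_def g_triple_def config_indices[OF cf] config_indices[OF Cons.prems] .
  have a: "act B w (l # X) = act B ?w X" by (simp add: act_def)
  have fl: "((br \<or> l = Letter_T) \<or> Letter_T \<in> set X) = (br \<or> Letter_T \<in> set (l # X))"
    by auto
  show ?case using Cons.IH[OF cf] unfolding a fl iterate_step.simps tr .
qed

lemma config_act_initial: "\<exists>k s t e. config (act B [i] X) k s t e (Letter_T \<in> set X)"
proof -
  obtain s t where "config [i] i s t (-1) False" using config_initial by blast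
  from triples_act[OF this, of X] show ?thesis by simp
qed

lemma admissible_config:
  assumes "admissible B w u"
  obtains br where "\<exists>k s t e. config w k s t e br" "\<exists>k s t e. config u k s t e br"
proof -
  have "\<exists>k s t e. config v k s t e False" if "in_trunk B v" for v
  proof -
    from that obtain i n where v: "v = act B [i] (replicate n Letter_S)" unfolding in_trunk_def by blast
    show ?thesis using config_act_initial[of i "replicate n Letter_S"] unfolding v by simp
  qed
  moreover have "\<exists>k s t e. config v k s t e True" if "in_branch B v" for v
  proof -
    from that obtain i X where v: "v = act B [i] X" and T: "Letter_T \<in> set X"
      unfolding in_branch_def by blast
    show ?thesis using config_act_initial[of i X] T unfolding v by simp
  qed
  ultimately show ?thesis
    using assms that[of False] that[of True] unfolding admissible_def by blast
qed

lemma config_frames: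
  assumes "config w k s t e br"
  shows "frame (c_triple w)" "frame (g_triple w)"
  using assms unfolding c_triple_def g_triple_def config_indices[OF assms] config_def by blast+

lemma transition_maps:
  assumes "admissible B w u"
  shows "\<exists>\<Phi> \<Psi>. linear \<Phi> \<and> bij \<Phi> \<and> linear \<Psi> \<and> bij \<Psi> \<and>
    (\<forall>X. map_triple \<Phi> (c_triple (act B w X)) = c_triple (act B u X) \<and>
         map_triple \<Psi> (g_triple (act B w X)) = g_triple (act B u X))"
proof -
  obtain br where "\<exists>k s t e. config w k s t e br" "\<exists>k s t e. config u k s t e br"
    using assms by (rule admissible_config)
  then obtain k s t e k' s' t' e' where w: "config w k s t e br" and u: "config u k' s' t' e' br"
    by blast
  obtain \<Phi> where \<Phi>: "linear \<Phi>" "bij \<Phi>" "map_triple \<Phi> (c_triple w) = c_triple u"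
    by (rule frame_transition[OF config_frames(1)[OF w] config_frames(1)[OF u]])
  obtain \<Psi> where \<Psi>: "linear \<Psi>" "bij \<Psi>" "map_triple \<Psi> (g_triple w) = g_triple u"
    by (rule frame_transition[OF config_frames(2)[OF w] config_frames(2)[OF u]])
  have "map_triple \<Phi> (c_triple (act B w X)) = c_triple (act B u X)" for X
    using triples_act[OF w, of X] triples_act[OF u, of X]
      iterate_step_commute[of c_step \<Phi> br X "c_triple w", OF step_linear(1)[OF \<Phi>(1)]] \<Phi>(3) by simp
  moreover have "map_triple \<Psi> (g_triple (act B w X)) = g_triple (act B u X)" for X
    using triples_act[OF w, of X] triples_act[OF u, of X]
      iterate_step_commute[of g_step \<Psi> br X "g_triple w", OF step_linear(2)[OF \<Psi>(1)]] \<Psi>(3) by simp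
  ultimately show ?thesis using \<Phi> \<Psi> by blast
qed

end

theorem theorem1p1:
  fixes p p' q q' r r' \<sigma> :: real and B :: "real^3^3" and d :: "real^3"
    and w u :: "3 list"
  assumes "p > 0" "p' > 0" "q > 0" "q' > 0" "r > 0" "r' > 0"
    and "p * p' = 4" "q * q' = 4" "r * r' = 4"
    and "p * q * r = p' * q' * r'"
    and "\<sigma> \<in> {1, - 1}"
    and "B = \<sigma> *\<^sub>R vector [vector [0, - p', r],
                          vector [p, 0, - q'],
                          vector [- r', q, 0]]"
    and "\<And>i. d $ i > 0"
    and "skew_symmetric (diag_mat d ** B)"
    and "w \<in> reduced_seqs - {[]}" "u \<in> reduced_seqs - {[]}"
    and "admissible B w u"
  shows "\<exists>\<Phi> \<Psi> :: real^3 \<Rightarrow> real^3.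
           linear \<Phi> \<and> bij \<Phi> \<and> linear \<Psi> \<and> bij \<Psi> \<and>
           (\<forall>M X. \<Phi> (ctilde B d (act B w X) (role_index B M (act B w X)))
                    = ctilde B d (act B u X) (role_index B M (act B u X))
                \<and> \<Psi> (gtilde B d (act B w X) (role_index B M (act B w X)))
                    = gtilde B d (act B u X) (role_index B M (act B u X)))"
proof -
  have norm: "\<bar>\<sigma>\<bar> = 1" using assms(11) by auto
  interpret symmetrized B d \<sigma>
  proof
    show "d $ i > 0" for i by (rule assms(13))
    show "\<bar>\<sigma>\<bar> = 1" by (rule norm)
    show "B $ i $ j * (d $ j) powr (-1/2) = (d $ i) powr (-1/2) * (2 * \<sigma> * orient i j)" for i j
      by (rule markov_entry_symmetrized[OF assms(1-9) assms(11-14)])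
  qed
  obtain \<Phi> \<Psi> where maps: "linear \<Phi>" "bij \<Phi>" "linear \<Psi>" "bij \<Psi>"
    and \<Phi>: "\<And>X. map_triple \<Phi> (c_triple (act B w X)) = c_triple (act B u X)"
    and \<Psi>: "\<And>X. map_triple \<Psi> (g_triple (act B w X)) = g_triple (act B u X)"
    using transition_maps[OF assms(17)] by blast
  have "\<Phi> (c (act B w X) (role_index B M (act B w X))) = c (act B u X) (role_index B M (act B u X))
      \<and> \<Psi> (g (act B w X) (role_index B M (act B w X))) = g (act B u X) (role_index B M (act B u X))" for M X
    using \<Phi>[of X] \<Psi>[of X] by (cases M) (simp_all add: c_triple_def g_triple_def)
  with maps show ?thesis by blast
qed

end
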